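(* Let $X$ be a real Banach space. If $X^*$ is fully Mackey complete, then $X$ is $w^*$-sequentially dense in $X^{**}$, i.e. every element of $X^{**}$ is the $w^*$-limit of a sequence in $X$.
   Context: For a Banach space $Z$, a linear subspace $Y\subset Z^*$ is norming if $|||z|||=\sup\{z^*(z): z^*\in Y,\ \|z^*\|\le 1\}$ defines an equivalent norm on $Z$. $Z$ is fully Mackey complete if $(Z,\mu(Z,Y))$ is complete for every norming and norm-closed subspace $Y\subset Z^*$, where $\mu(Z,Y)$ is the locally convex topology on $Z$ of uniform convergence on absolutely convex $w^*$-compact subsets of $Y$. Here this is applied with $Z=X^*$. *)

theory Defs
  imports "HOL-Analysis.Analysis"
begin

definition weak_star_topology :: "('z::real_normed_vector \<Rightarrow>\<^sub>L real) topology" where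
  "weak_star_topology =
     topology_generated_by {{y. blinfun_apply y z \<in> U} | z U. open (U :: real set)}"

text \<open>Y \<subseteq> Z* is norming: the functional |||z||| = sup of y(z) over the unit ball of Y
  defines an equivalent norm on Z (the bound |||z||| \<le> ||z|| is automatic).\<close>
definition norming :: "('z::real_normed_vector \<Rightarrow>\<^sub>L real) set \<Rightarrow> bool" where
  "norming Y \<longleftrightarrow> (\<exists>c>0. \<forall>z. c * norm z \<le> Sup {blinfun_apply y z | y. y \<in> Y \<and> norm y \<le> 1})"

definition absolutely_convex :: "'v::real_vector set \<Rightarrow> bool" where
  "absolutely_convex K \<longleftrightarrow> convex K \<and> (\<forall>y\<in>K. \<forall>a::real. \<bar>a\<bar> \<le> 1 \<longrightarrow> a *\<^sub>R y \<in> K)"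

definition mackey_sets :: "('z::real_normed_vector \<Rightarrow>\<^sub>L real) set \<Rightarrow> ('z \<Rightarrow>\<^sub>L real) set set" where
  "mackey_sets Y = {K. K \<subseteq> Y \<and> absolutely_convex K \<and> compactin weak_star_topology K}"

definition mackey_cauchy :: "('z::real_normed_vector \<Rightarrow>\<^sub>L real) set \<Rightarrow> 'z filter \<Rightarrow> bool" where
  "mackey_cauchy Y F \<longleftrightarrow> (\<forall>K\<in>mackey_sets Y. \<forall>e>0.
      \<forall>\<^sub>F (a, b) in F \<times>\<^sub>F F. \<forall>y\<in>K. \<bar>blinfun_apply y a - blinfun_apply y b\<bar> \<le> e)"

definition mackey_converges :: "('z::real_normed_vector \<Rightarrow>\<^sub>L real) set \<Rightarrow> 'z filter \<Rightarrow> 'z \<Rightarrow> bool" where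
  "mackey_converges Y F z \<longleftrightarrow> (\<forall>K\<in>mackey_sets Y. \<forall>e>0.
      \<forall>\<^sub>F a in F. \<forall>y\<in>K. \<bar>blinfun_apply y a - blinfun_apply y z\<bar> \<le> e)"

definition mackey_complete :: "('z::real_normed_vector \<Rightarrow>\<^sub>L real) set \<Rightarrow> bool" where
  "mackey_complete Y \<longleftrightarrow> (\<forall>F. F \<noteq> bot \<and> mackey_cauchy Y F \<longrightarrow> (\<exists>z. mackey_converges Y F z))"

definition fully_mackey_complete :: "'z::real_normed_vector itself \<Rightarrow> bool" where
  "fully_mackey_complete _ \<longleftrightarrow>
     (\<forall>Y :: ('z \<Rightarrow>\<^sub>L real) set. subspace Y \<and> closed Y \<and> norming Y \<longrightarrow> mackey_complete Y)"

end

theory Submission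
  imports Defs
begin

text \<open>
  Let \<open>\<phi> \<in> X**\<close> lie outside \<open>X\<close>. The space \<open>E = X \<oplus> \<real>\<phi>\<close> is closed and norming, and the functional
  \<open>h\<close> on \<open>E\<close> that vanishes on \<open>X\<close> and has \<open>h \<phi> = 1\<close> is not evaluation at an element of \<open>X*\<close>.
  By Mackey completeness and Grothendieck's completeness theorem, \<open>h\<close> is therefore not
  \<open>w*\<close>-continuous on some absolutely convex \<open>w*\<close>-compact \<open>K \<subseteq> E\<close>: the point \<open>0\<close> lies in the
  \<open>w*\<close>-closure of a level set \<open>{k \<in> K. h k = e}\<close> with \<open>e > 0\<close>.

  Whitley's construction from the Eberlein--Smulian theorem extracts a sequence \<open>k n\<close> in that level
  set whose closed linear span meets the span of its \<open>w*\<close>-cluster points only in \<open>0\<close>. By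
  Hahn--Banach, a combination of the cluster points of \<open>k n - k 0 \<in> X\<close> that lies in \<open>X\<close> belongs to
  the closed span of the sequence. Since \<open>E / X\<close> is one-dimensional, any two cluster points have such
  a nontrivial combination; hence the cluster point \<open>u\<close> is unique and \<open>h u \<noteq> e\<close>. So \<open>k n - k 0\<close>
  converges to \<open>u - k 0 \<in> X + c \<phi>\<close> with \<open>c \<noteq> 0\<close>, and \<open>\<phi>\<close> is the limit of a sequence in \<open>X\<close>.
\<close>

section \<open>The Hahn--Banach and Mazur--Orlicz theorems\<close>

definition sublinear :: "('v::real_vector \<Rightarrow> real) \<Rightarrow> bool" where
  "sublinear P \<longleftrightarrow> (\<forall>x y. P (x + y) \<le> P x + P y) \<and> (\<forall>c\<ge>0. \<forall>x. P (c *\<^sub>R x) = c * P x)"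

lemma sublinearI:
  assumes add: "\<And>x y. P (x + y) \<le> P x + P y"
    and scale_le: "\<And>c x. c > 0 \<Longrightarrow> P (c *\<^sub>R x) \<le> c * P x"
  shows "sublinear P"
proof -
  have zero: "P 0 = 0" using scale_le[of 2 0] scale_le[of "1/2" 0] by simp
  have "P (c *\<^sub>R x) = c * P x" if "c > 0" for c x
  proof (rule antisym)
    have "P x \<le> inverse c * P (c *\<^sub>R x)" using scale_le[of "inverse c" "c *\<^sub>R x"] that by simp
    then show "c * P x \<le> P (c *\<^sub>R x)" using that by (simp add: field_simps)
  qed (rule scale_le[OF that])
  with zero have "P (c *\<^sub>R x) = c * P x" if "c \<ge> 0" for c x
    using that by (cases "c = 0") auto
  with add show ?thesis by (auto simp: sublinear_def)
qed

lemma sublinear_add: "sublinear P \<Longrightarrow> P (x + y) \<le> P x + P y"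
  by (simp add: sublinear_def)

lemma sublinear_scale: "sublinear P \<Longrightarrow> c \<ge> 0 \<Longrightarrow> P (c *\<^sub>R x) = c * P x"
  by (simp add: sublinear_def)

lemma sublinear_zero: "sublinear P \<Longrightarrow> P 0 = 0"
  using sublinear_scale[of P 0 0] by simp

lemma sublinear_minus: "sublinear P \<Longrightarrow> - P (- x) \<le> P x"
  using sublinear_add[of P x "- x"] sublinear_zero[of P] by simp

lemma sublinear_norm: "sublinear (norm :: 'v::real_normed_vector \<Rightarrow> real)"
  by (rule sublinearI) (auto simp: norm_triangle_ineq)

locale sublinear_family =
  fixes Q :: "'v::real_vector \<Rightarrow> real set"
  assumes nonempty: "Q x \<noteq> {}"
    and bdd_below_0: "bdd_below (Q 0)"
    and add: "r \<in> Q x \<Longrightarrow> s \<in> Q y \<Longrightarrow> \<exists>t\<in>Q (x + y). t \<le> r + s"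
    and scale: "c > 0 \<Longrightarrow> r \<in> Q x \<Longrightarrow> \<exists>s\<in>Q (c *\<^sub>R x). s \<le> c * r"
begin

lemma bdd_below: "bdd_below (Q x)"
proof -
  obtain m where m: "\<And>r. r \<in> Q 0 \<Longrightarrow> m \<le> r" using bdd_below_0 by (auto simp: bdd_below_def)
  obtain s where s: "s \<in> Q (- x)" using nonempty by blast
  have "m - s \<le> r" if "r \<in> Q x" for r using add[OF that s] m by force
  then show ?thesis by (rule bdd_belowI)
qed

lemma Inf_le: "r \<in> Q x \<Longrightarrow> Inf (Q x) \<le> r"
  using bdd_below by (rule cInf_lower[rotated])

lemma sublinear_Inf: "sublinear (\<lambda>x. Inf (Q x))"
proof (rule sublinearI)
  fix x y
  have "Inf (Q (x + y)) \<le> r + s" if "r \<in> Q x" "s \<in> Q y" for r s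
    using add[OF that] by (blast intro: order_trans Inf_le)
  then have "Inf (Q (x + y)) - s \<le> Inf (Q x)" if "s \<in> Q y" for s
    using that by (intro cInf_greatest nonempty) (simp add: algebra_simps)
  then have "Inf (Q (x + y)) - Inf (Q x) \<le> Inf (Q y)"
    by (intro cInf_greatest nonempty) (simp add: algebra_simps)
  then show "Inf (Q (x + y)) \<le> Inf (Q x) + Inf (Q y)" by simp
next
  fix c :: real and x assume c: "c > 0"
  have "Inf (Q (c *\<^sub>R x)) \<le> c * r" if "r \<in> Q x" for r
    using scale[OF c that] by (blast intro: order_trans Inf_le)
  then have "Inf (Q (c *\<^sub>R x)) / c \<le> Inf (Q x)"
    using c by (intro cInf_greatest nonempty) (simp add: field_simps)
  then show "Inf (Q (c *\<^sub>R x)) \<le> c * Inf (Q x)" using c by (simp add: field_simps)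
qed

end

lemma sublinear_family_directed:
  fixes C :: "('v::real_vector \<Rightarrow> real) set"
  assumes ne: "C \<noteq> {}" and sublin: "\<And>p. p \<in> C \<Longrightarrow> sublinear p"
    and directed: "\<And>p q. p \<in> C \<Longrightarrow> q \<in> C \<Longrightarrow> \<exists>r\<in>C. r \<le> p \<and> r \<le> q"
  shows "sublinear_family (\<lambda>x. (\<lambda>p. p x) ` C)"
proof
  show "(\<lambda>p. p x) ` C \<noteq> {}" for x using ne by simp
  show "bdd_below ((\<lambda>p. p 0) ` C)"
    using sublinear_zero[OF sublin] by (force intro: bdd_belowI2[of _ 0])
  show "\<exists>t\<in>(\<lambda>p. p (x + y)) ` C. t \<le> r + s"
    if rs: "r \<in> (\<lambda>p. p x) ` C" "s \<in> (\<lambda>p. p y) ` C" for r s x y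
  proof -
    obtain p q where pq: "p \<in> C" "q \<in> C" "r = p x" "s = q y" using rs by auto
    obtain u where u: "u \<in> C" "u \<le> p" "u \<le> q" using directed[OF pq(1,2)] by blast
    have "u (x + y) \<le> u x + u y" using sublin[OF u(1)] by (rule sublinear_add)
    also have "\<dots> \<le> r + s" using u(2,3) pq(3,4) by (auto simp: le_fun_def intro: add_mono)
    finally show ?thesis using u(1) by auto
  qed
  show "\<exists>s\<in>(\<lambda>p. p (c *\<^sub>R x)) ` C. s \<le> c * r" if "c > 0" "r \<in> (\<lambda>p. p x) ` C" for c r x
    using that sublinear_scale[OF sublin] by force
qed

lemma sublinear_chain_lower_bound:
  fixes P :: "'v::real_vector \<Rightarrow> real"
  assumes P: "sublinear P" and sublin: "\<And>p. p \<in> C \<Longrightarrow> sublinear p \<and> p \<le> P"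
    and chain: "\<And>p q. p \<in> C \<Longrightarrow> q \<in> C \<Longrightarrow> p \<le> q \<or> q \<le> p"
  shows "\<exists>u. sublinear u \<and> u \<le> P \<and> (\<forall>p\<in>C. u \<le> p)"
proof (cases "C = {}")
  case True
  with P show ?thesis by auto
next
  case False
  have "\<exists>r\<in>C. r \<le> p \<and> r \<le> q" if "p \<in> C" "q \<in> C" for p q
    using chain[OF that] that by blast
  then interpret sublinear_family "\<lambda>x. (\<lambda>p. p x) ` C"
    using False sublin by (intro sublinear_family_directed) auto
  define u where "u x = (INF p\<in>C. p x)" for x
  have "sublinear u" unfolding u_def by (rule sublinear_Inf)
  moreover have lower: "u \<le> p" if "p \<in> C" for p
    unfolding u_def le_fun_def using that by (blast intro: Inf_le)
  moreover obtain p where "p \<in> C" using False by blast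
  then have "u \<le> P" using lower sublin order_trans by blast
  ultimately show ?thesis by blast
qed

lemma sublinear_minimal_below:
  fixes P :: "'v::real_vector \<Rightarrow> real"
  assumes "sublinear P"
  obtains f where "sublinear f" "f \<le> P" "\<And>p. sublinear p \<Longrightarrow> p \<le> f \<Longrightarrow> p = f"
proof -
  define A where "A = {p. sublinear p \<and> p \<le> P}"
  have "\<exists>f\<in>A. \<forall>p\<in>A. p \<le> f \<longrightarrow> p = f"
  proof (rule predicate_Zorn)
    show "partial_order_on A (relation_of (\<lambda>p q. q \<le> p) A)"
      by (rule partial_order_on_relation_ofI) auto
    fix C assume "C \<in> Chains (relation_of (\<lambda>p q. q \<le> p) A)"
    then have "C \<subseteq> A" "\<And>p q. p \<in> C \<Longrightarrow> q \<in> C \<Longrightarrow> p \<le> q \<or> q \<le> p"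
      by (auto simp: Chains_def relation_of_def)
    then show "\<exists>u\<in>A. \<forall>p\<in>C. u \<le> p"
      using sublinear_chain_lower_bound[OF assms, of C] by (auto simp: A_def)
  qed
  then obtain f where "f \<in> A" and minimal: "\<And>p. p \<in> A \<Longrightarrow> p \<le> f \<Longrightarrow> p = f" by blast
  then have f: "sublinear f" "f \<le> P" by (auto simp: A_def)
  with minimal show thesis by (intro that[of f]) (auto simp: A_def intro: order_trans)
qed

lemma concave_on_singleton: "concave_on {x} f"
  by (auto simp: concave_on_iff simp flip: scaleR_add_left distrib_right)

lemma concave_on_cone_combination:
  assumes g: "concave_on K g" and kl: "k \<in> K" "l \<in> K" and ab: "0 \<le> a" "0 \<le> b"
  obtains m where "m \<in> K" "(a + b) *\<^sub>R m = a *\<^sub>R k + b *\<^sub>R l" "a * g k + b * g l \<le> (a + b) * g m"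
proof (cases "a + b = 0")
  case True
  with ab have "a = 0" "b = 0" by auto
  with kl show ?thesis by (intro that[of k]) auto
next
  case False
  with ab have pos: "a + b > 0" by simp
  define m where "m = (a / (a + b)) *\<^sub>R k + (b / (a + b)) *\<^sub>R l"
  have weights: "0 \<le> a / (a + b)" "0 \<le> b / (a + b)" "a / (a + b) + b / (a + b) = 1"
    using ab pos by (auto simp flip: add_divide_distrib)
  show ?thesis
  proof (rule that)
    show "m \<in> K" unfolding m_def using kl weights g by (intro convexD) (auto simp: concave_on_iff)
    show "(a + b) *\<^sub>R m = a *\<^sub>R k + b *\<^sub>R l" using pos by (simp add: m_def scaleR_add_right)
    have "a / (a + b) * g k + b / (a + b) * g l \<le> g m"
      unfolding m_def using g kl weights unfolding concave_on_iff by blast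
    then have "(a * g k + b * g l) / (a + b) \<le> g m" by (simp add: add_divide_distrib)
    then show "a * g k + b * g l \<le> (a + b) * g m" using pos by (simp add: divide_le_eq mult.commute)
  qed
qed

definition lowered_values :: "('v::real_vector \<Rightarrow> real) \<Rightarrow> 'v set \<Rightarrow> ('v \<Rightarrow> real) \<Rightarrow> 'v \<Rightarrow> real set" where
  "lowered_values P K g y = {P (y + t *\<^sub>R k) - t * g k | t k. 0 \<le> t \<and> k \<in> K}"

text \<open>A linear functional below \<open>lowered P K g\<close> lies below \<open>P\<close> (take \<open>t = 0\<close>) and above \<open>g\<close> on \<open>K\<close>
  (evaluate at \<open>- k\<close> with \<open>t = 1\<close>).\<close>
definition lowered :: "('v::real_vector \<Rightarrow> real) \<Rightarrow> 'v set \<Rightarrow> ('v \<Rightarrow> real) \<Rightarrow> 'v \<Rightarrow> real" where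
  "lowered P K g y = Inf (lowered_values P K g y)"

lemma sublinear_family_lowered_values:
  fixes P :: "'v::real_vector \<Rightarrow> real"
  assumes P: "sublinear P" and K: "K \<noteq> {}" and g: "concave_on K g" and g_le: "\<And>k. k \<in> K \<Longrightarrow> g k \<le> P k"
  shows "sublinear_family (lowered_values P K g)"
proof
  show "lowered_values P K g y \<noteq> {}" for y using K by (auto simp: lowered_values_def)
  show "bdd_below (lowered_values P K g 0)"
    using g_le
    by (intro bdd_belowI[of _ 0])
      (auto simp: lowered_values_def sublinear_scale[OF P] mult_left_mono)
  show "\<exists>t\<in>lowered_values P K g (x + y). t \<le> r + s"
    if rs: "r \<in> lowered_values P K g x" "s \<in> lowered_values P K g y" for r s x y
  proof -
    obtain a k b l where a: "0 \<le> a" "k \<in> K" "r = P (x + a *\<^sub>R k) - a * g k"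
      and b: "0 \<le> b" "l \<in> K" "s = P (y + b *\<^sub>R l) - b * g l"
      using rs by (auto simp: lowered_values_def)
    obtain m where m: "m \<in> K" "(a + b) *\<^sub>R m = a *\<^sub>R k + b *\<^sub>R l"
        "a * g k + b * g l \<le> (a + b) * g m"
      using concave_on_cone_combination[OF g a(2) b(2) a(1) b(1)] by blast
    define t where "t = P (x + y + (a + b) *\<^sub>R m) - (a + b) * g m"
    have "x + y + (a + b) *\<^sub>R m = (x + a *\<^sub>R k) + (y + b *\<^sub>R l)" unfolding m(2) by simp
    also have "P \<dots> \<le> P (x + a *\<^sub>R k) + P (y + b *\<^sub>R l)" using P by (rule sublinear_add)
    finally have "t \<le> r + s" unfolding t_def a(3) b(3) using m(3) by linarith
    moreover have "t \<in> lowered_values P K g (x + y)"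
      unfolding lowered_values_def t_def using a(1) b(1) m(1)
      by (intro CollectI exI[of _ "a + b"] exI[of _ m]) auto
    ultimately show ?thesis by blast
  qed
  show "\<exists>s\<in>lowered_values P K g (c *\<^sub>R x). s \<le> c * r"
    if c: "c > 0" and r: "r \<in> lowered_values P K g x" for c r x
  proof -
    obtain t k where t: "0 \<le> t" "k \<in> K" "r = P (x + t *\<^sub>R k) - t * g k"
      using r by (auto simp: lowered_values_def)
    have "c * r = P (c *\<^sub>R x + (c * t) *\<^sub>R k) - (c * t) * g k"
      using sublinear_scale[OF P, of c "x + t *\<^sub>R k"] c by (simp add: t(3) algebra_simps)
    moreover have "\<dots> \<in> lowered_values P K g (c *\<^sub>R x)"
      using t(1,2) c by (force simp: lowered_values_def)
    ultimately show ?thesis by (metis order_refl)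
  qed
qed

lemma
  fixes P :: "'v::real_vector \<Rightarrow> real"
  assumes "sublinear P" "K \<noteq> {}" "concave_on K g" "\<And>k. k \<in> K \<Longrightarrow> g k \<le> P k"
  shows sublinear_lowered: "sublinear (lowered P K g)"
    and lowered_le: "0 \<le> t \<Longrightarrow> k \<in> K \<Longrightarrow> lowered P K g y \<le> P (y + t *\<^sub>R k) - t * g k"
proof -
  interpret sublinear_family "lowered_values P K g"
    using assms by (rule sublinear_family_lowered_values)
  show "sublinear (lowered P K g)" unfolding lowered_def by (rule sublinear_Inf)
  show "lowered P K g y \<le> P (y + t *\<^sub>R k) - t * g k" if "0 \<le> t" "k \<in> K"
    unfolding lowered_def using that by (intro Inf_le) (auto simp: lowered_values_def)
qed

lemma minimal_sublinear_imp_linear: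
  fixes f :: "'v::real_vector \<Rightarrow> real"
  assumes f: "sublinear f" and minimal: "\<And>p. sublinear p \<Longrightarrow> p \<le> f \<Longrightarrow> p = f"
  shows "linear f"
proof -
  have odd: "f (- x) = - f x" for x
  proof (rule antisym)
    note lowered = sublinear_lowered[of f "{x}" f, OF f _ concave_on_singleton]
      lowered_le[of f "{x}" f, OF f _ concave_on_singleton]
    have "lowered f {x} f = f"
      using lowered(1) lowered(2)[of 0 x] by (intro minimal) (auto simp: le_fun_def)
    then show "f (- x) \<le> - f x" using lowered(2)[of 1 x "- x"] sublinear_zero[OF f] by simp
    show "- f x \<le> f (- x)" using sublinear_minus[OF f, of x] by simp
  qed
  show ?thesis
  proof (rule linearI)
    show "f (x + y) = f x + f y" for x y
      using sublinear_add[OF f, of x y] sublinear_add[OF f, of "- x" "- y"] odd[of "x + y"] odd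
      by simp
    show "f (c *\<^sub>R x) = c *\<^sub>R f x" for c x
      using sublinear_scale[OF f, of c x] sublinear_scale[OF f, of "- c" x] odd[of "c *\<^sub>R x"]
      by (cases "c \<ge> 0") auto
  qed
qed

theorem mazur_orlicz:
  fixes P :: "'v::real_vector \<Rightarrow> real"
  assumes "sublinear P" "K \<noteq> {}" "concave_on K g" "\<And>k. k \<in> K \<Longrightarrow> g k \<le> P k"
  obtains f where "linear f" "\<And>x. f x \<le> P x" "\<And>k. k \<in> K \<Longrightarrow> g k \<le> f k"
proof -
  note lowered_le = lowered_le[OF assms]
  obtain f where f: "sublinear f" "f \<le> lowered P K g" and minimal: "\<And>p. sublinear p \<Longrightarrow> p \<le> f \<Longrightarrow> p = f"
    using sublinear_minimal_below[OF sublinear_lowered[OF assms]] by blast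
  have lin: "linear f" using f(1) minimal by (rule minimal_sublinear_imp_linear)
  show thesis
  proof (rule that[OF lin])
    obtain k where "k \<in> K" using assms(2) by blast
    then show "f x \<le> P x" for x using le_funD[OF f(2), of x] lowered_le[of 0 k x] by simp
    show "g k \<le> f k" if "k \<in> K" for k
      using le_funD[OF f(2), of "- k"] lowered_le[of 1 k "- k"] that sublinear_zero[OF assms(1)]
        linear_neg[OF lin, of k] by simp
  qed
qed

corollary hahn_banach_supporting_functional:
  fixes P :: "'v::real_normed_vector \<Rightarrow> real"
  assumes P: "sublinear P" and bound: "\<And>y. P y \<le> C * norm y"
  obtains f :: "'v \<Rightarrow>\<^sub>L real" where "\<And>y. f y \<le> P y" "f x = P x"
proof -
  obtain f where f: "linear f" "\<And>y. f y \<le> P y" "P x \<le> f x"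
    using mazur_orlicz[OF P, of "{x}" P] concave_on_singleton by auto
  have "norm (f y) \<le> norm y * C" for y
    using order_trans[OF f(2) bound, of y] order_trans[OF f(2) bound, of "- y"]
      linear_neg[OF f(1), of y]
    by (simp add: abs_le_iff mult.commute)
  then have "bounded_linear f"
    using f(1) by (intro bounded_linear_intro) (auto simp: linear_add linear_scale)
  then have "blinfun_apply (Blinfun f) = f" by (rule bounded_linear_Blinfun_apply)
  with f show thesis by (intro that[of "Blinfun f"]) (auto intro: antisym)
qed

lemma sublinear_infdist:
  fixes S :: "'v::real_normed_vector set"
  assumes S: "subspace S"
  shows "sublinear (\<lambda>x. infdist x S)"
proof -
  have ne: "S \<noteq> {}" using subspace_0[OF S] by blast
  interpret sublinear_family "\<lambda>x. dist x ` S"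
  proof
    show "dist x ` S \<noteq> {}" for x using ne by simp
    show "bdd_below (dist 0 ` S)" by (auto intro: bdd_belowI2[of _ 0])
    show "\<exists>t\<in>dist (x + y) ` S. t \<le> r + s" if rs: "r \<in> dist x ` S" "s \<in> dist y ` S" for x y r s
    proof -
      obtain a b where "a \<in> S" "b \<in> S" "r = dist x a" "s = dist y b" using rs by auto
      then show ?thesis using subspace_add[OF S] dist_triangle_add[of x y a b] by auto
    qed
    show "\<exists>s\<in>dist (c *\<^sub>R x) ` S. s \<le> c * r" if c: "c > 0" and r: "r \<in> dist x ` S" for c x r
    proof -
      obtain a where a: "a \<in> S" "r = dist x a" using r by auto
      have "dist (c *\<^sub>R x) (c *\<^sub>R a) = c * r"
        using c by (simp add: a(2) dist_norm flip: scaleR_diff_right)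
      with subspace_scale[OF S a(1), of c] show ?thesis by (metis imageI order_refl)
    qed
  qed
  show ?thesis using sublinear_Inf ne by (simp add: infdist_notempty)
qed

corollary hahn_banach_closed_subspace:
  fixes x :: "'v::real_normed_vector"
  assumes S: "subspace S" "closed S" and x: "x \<notin> S"
  obtains f :: "'v \<Rightarrow>\<^sub>L real" where "\<And>s. s \<in> S \<Longrightarrow> f s = 0" "f x = 1"
proof -
  have zero: "0 \<in> S" using S(1) by (rule subspace_0)
  have "infdist y S \<le> 1 * norm y" for y using infdist_le[OF zero, of y] by simp
  then obtain f :: "'v \<Rightarrow>\<^sub>L real" where f: "\<And>y. f y \<le> infdist y S" "f x = infdist x S"
    using hahn_banach_supporting_functional[OF sublinear_infdist[OF S(1)], of 1 x] by blast
  have "infdist x S \<noteq> 0" using in_closed_iff_infdist_zero[OF S(2)] zero x by blast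
  moreover have "f s = 0" if "s \<in> S" for s
    using f(1)[of s] f(1)[of "- s"] that subspace_neg[OF S(1) that]
    by (simp add: blinfun.minus_right)
  ultimately show thesis
    using f(2) by (intro that[of "inverse (infdist x S) *\<^sub>R f"]) (auto simp: blinfun.scaleR_left)
qed

lemma subspace_closure:
  fixes S :: "'v::real_normed_vector set"
  assumes S: "subspace S"
  shows "subspace (closure S)"
proof (rule subspaceI)
  show "0 \<in> closure S" using subspace_0[OF S] closure_subset by blast
  show "x + y \<in> closure S" if "x \<in> closure S" "y \<in> closure S" for x y
  proof -
    obtain a where "\<And>n. a n \<in> S" "a \<longlonglongrightarrow> x" using \<open>x \<in> _\<close> unfolding closure_sequential by blast
    moreover obtain b where "\<And>n. b n \<in> S" "b \<longlonglongrightarrow> y"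
      using \<open>y \<in> _\<close> unfolding closure_sequential by blast
    ultimately show ?thesis unfolding closure_sequential
      by (intro exI[of _ "\<lambda>n. a n + b n"]) (auto intro: subspace_add[OF S] tendsto_add)
  qed
  show "c *\<^sub>R x \<in> closure S" if "x \<in> closure S" for c x
  proof -
    obtain a where "\<And>n. a n \<in> S" "a \<longlonglongrightarrow> x" using \<open>x \<in> _\<close> unfolding closure_sequential by blast
    then show ?thesis unfolding closure_sequential
      by (intro exI[of _ "\<lambda>n. c *\<^sub>R a n"]) (auto intro: subspace_scale[OF S] tendsto_scaleR)
  qed
qed

corollary in_closure_span_if_annihilated:
  fixes y :: "'v::real_normed_vector"
  assumes "\<And>f :: 'v \<Rightarrow>\<^sub>L real. (\<And>a. a \<in> A \<Longrightarrow> f a = 0) \<Longrightarrow> f y = 0"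
  shows "y \<in> closure (span A)"
proof (rule ccontr)
  assume "y \<notin> closure (span A)"
  then obtain f :: "'v \<Rightarrow>\<^sub>L real" where f: "\<And>s. s \<in> closure (span A) \<Longrightarrow> f s = 0" "f y = 1"
    using hahn_banach_closed_subspace[OF subspace_closure[OF subspace_span] closed_closure] by blast
  have "f a = 0" if "a \<in> A" for a using that span_base closure_subset by (blast intro: f(1))
  with assms[of f] f(2) show False by simp
qed

lemma in_span_insert_subspace_iff:
  fixes h :: "'v::real_vector \<Rightarrow> real"
  assumes S: "subspace S" and h: "linear h" "\<And>s. s \<in> S \<Longrightarrow> h s = 0" "h x = 1"
  shows "y \<in> span (insert x S) \<longleftrightarrow> y - h y *\<^sub>R x \<in> S"
proof -
  have "h y = c" if "y - c *\<^sub>R x \<in> S" for c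
    using h(2)[OF that] h(3) by (simp add: linear_diff[OF h(1)] linear_scale[OF h(1)])
  moreover have span: "span S = S" using span_eq_iff[of S] S by blast
  ultimately show ?thesis unfolding span_insert span by auto
qed

lemma linear_blinfun_apply: "linear (blinfun_apply f)"
  by (rule bounded_linear.linear[OF blinfun.bounded_linear_right])

corollary closed_span_insert:
  fixes x :: "'v::real_normed_vector"
  assumes S: "subspace S" "closed S"
  shows "closed (span (insert x S))"
proof (cases "x \<in> S")
  case True
  then have "span (insert x S) = S" using S(1) by (simp add: insert_absorb)
  with S(2) show ?thesis by simp
next
  case False
  then obtain f :: "'v \<Rightarrow>\<^sub>L real" where f: "\<And>s. s \<in> S \<Longrightarrow> f s = 0" "f x = 1"
    using hahn_banach_closed_subspace[OF S] by blast
  have lin: "linear f" by (rule linear_blinfun_apply)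
  have "span (insert x S) = (\<lambda>y. y - f y *\<^sub>R x) -` S"
    using in_span_insert_subspace_iff[OF S(1) lin f] by blast
  also have "closed \<dots>"
    using S(2) by (rule continuous_closed_vimage) (intro continuous_intros)
  finally show ?thesis .
qed

section \<open>Cluster points\<close>

definition cluster_pointin :: "'a topology \<Rightarrow> ('b \<Rightarrow> 'a) \<Rightarrow> 'a \<Rightarrow> 'b filter \<Rightarrow> bool" where
  "cluster_pointin T x q F \<longleftrightarrow>
     q \<in> topspace T \<and> (\<forall>U. openin T U \<longrightarrow> q \<in> U \<longrightarrow> (\<exists>\<^sub>F n in F. x n \<in> U))"

lemma compactin_imp_cluster_point:
  assumes K: "compactin T K" and F: "F \<noteq> bot" "\<forall>\<^sub>F n in F. x n \<in> K"
  shows "\<exists>q\<in>K. cluster_pointin T x q F"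
proof (rule ccontr)
  assume none: "\<not> (\<exists>q\<in>K. cluster_pointin T x q F)"
  define \<U> where "\<U> = {U. openin T U \<and> (\<forall>\<^sub>F n in F. x n \<notin> U)}"
  have "K \<subseteq> \<Union>\<U>"
    using none compactin_subset_topspace[OF K]
    by (fastforce simp: \<U>_def cluster_pointin_def frequently_def)
  then obtain \<V> where \<V>: "finite \<V>" "\<V> \<subseteq> \<U>" "K \<subseteq> \<Union>\<V>"
    using compactinD[OF K, of \<U>] by (auto simp: \<U>_def)
  then have "\<forall>\<^sub>F n in F. \<forall>U\<in>\<V>. x n \<notin> U"
    by (intro eventually_ball_finite) (auto simp: \<U>_def)
  with F(2) have "\<forall>\<^sub>F n in F. False" by eventually_elim (use \<V>(3) in blast)
  with F(1) show False by simp
qed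

lemma cluster_pointin_mono: "cluster_pointin T x q F \<Longrightarrow> F \<le> G \<Longrightarrow> cluster_pointin T x q G"
  unfolding cluster_pointin_def frequently_def by (blast dest: filter_leD)

lemma cluster_pointin_continuous_map:
  assumes g: "continuous_map T T' g" and q: "cluster_pointin T x q F"
  shows "cluster_pointin T' (g \<circ> x) (g q) F"
  unfolding cluster_pointin_def
proof (intro conjI allI impI)
  show "g q \<in> topspace T'" using g q by (auto simp: cluster_pointin_def continuous_map_def)
  fix U assume U: "openin T' U" "g q \<in> U"
  define V where "V = {y \<in> topspace T. g y \<in> U}"
  have "openin T V" unfolding V_def using g U(1) by (rule openin_continuous_map_preimage)
  moreover have "q \<in> V" using q U(2) by (simp add: cluster_pointin_def V_def)
  ultimately have "\<exists>\<^sub>F n in F. x n \<in> V" using q by (simp add: cluster_pointin_def)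
  then show "\<exists>\<^sub>F n in F. (g \<circ> x) n \<in> U" by (rule frequently_elim1) (simp add: V_def)
qed

lemma cluster_pointin_eq_limit:
  assumes "Hausdorff_space T" and q: "cluster_pointin T x q F" and l: "limitin T x l F"
  shows "q = l"
proof (rule ccontr)
  have "q \<in> topspace T" "l \<in> topspace T"
    using q l by (auto simp: cluster_pointin_def limitin_topspace)
  moreover assume "q \<noteq> l"
  ultimately obtain U V where UV: "openin T U" "openin T V" "q \<in> U" "l \<in> V" "disjnt U V"
    using assms(1) unfolding Hausdorff_space_def by metis
  have "\<forall>\<^sub>F n in F. x n \<in> V" using l UV(2,4) by (rule limitinD)
  then have "\<forall>\<^sub>F n in F. x n \<notin> U" by (rule eventually_mono) (use UV(5) in \<open>auto simp: disjnt_iff\<close>)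
  with q UV(1,3) show False by (simp add: cluster_pointin_def frequently_def)
qed

lemma limitin_if_unique_cluster_point:
  assumes K: "compactin T K" and x: "\<forall>\<^sub>F n in F. x n \<in> K" and q: "q \<in> topspace T"
    and unique: "\<And>q'. q' \<in> K \<Longrightarrow> cluster_pointin T x q' F \<Longrightarrow> q' = q"
  shows "limitin T x q F"
  unfolding limitin_def
proof (intro conjI allI impI)
  fix U assume U: "openin T U \<and> q \<in> U"
  define G where "G = inf F (principal {n. x n \<notin> U})"
  have "G = bot"
  proof (rule ccontr)
    assume "G \<noteq> bot"
    moreover have "\<forall>\<^sub>F n in G. x n \<in> K" using x filter_leD[of G F] by (simp add: G_def)
    ultimately obtain q' where q': "q' \<in> K" "cluster_pointin T x q' G"
      using compactin_imp_cluster_point[OF K] by blast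
    have "q' = q" by (rule unique[OF q'(1) cluster_pointin_mono[OF q'(2)]]) (simp add: G_def)
    with q'(2) U have "\<exists>\<^sub>F n in G. x n \<in> U" by (simp add: cluster_pointin_def)
    moreover have "\<forall>\<^sub>F n in G. x n \<notin> U" by (simp add: G_def eventually_inf_principal)
    ultimately show False by (simp add: frequently_def)
  qed
  then show "\<forall>\<^sub>F n in F. x n \<in> U"
    by (simp add: G_def trivial_limit_def eventually_inf_principal)
qed (rule q)

section \<open>The weak-star topology\<close>

lemma topspace_weak_star [simp]: "topspace weak_star_topology = UNIV"
proof -
  have "UNIV \<in> {{y :: 'a \<Rightarrow>\<^sub>L real. y z \<in> U} | z U. open U}"
    by (auto intro!: exI[of _ 0] exI[of _ UNIV])
  then show ?thesis unfolding weak_star_topology_def topology_generated_by_topspace by blast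
qed

lemma openin_weak_star_eval: "open U \<Longrightarrow> openin weak_star_topology {y. blinfun_apply y z \<in> U}"
  unfolding weak_star_topology_def by (rule topology_generated_by_Basis) auto

lemma continuous_map_weak_star_eval:
  "continuous_map weak_star_topology euclideanreal (\<lambda>y. blinfun_apply y z)"
  by (auto simp: continuous_map_def intro: openin_weak_star_eval)

lemma continuous_map_into_weak_star:
  fixes f :: "'a \<Rightarrow> 'b::real_normed_vector \<Rightarrow>\<^sub>L real"
  assumes "\<And>z. continuous_map T euclideanreal (\<lambda>x. f x z)"
  shows "continuous_map T weak_star_topology f"
  unfolding weak_star_topology_def
proof (rule continuous_on_generated_topo)
  fix V assume "V \<in> {{y :: 'b \<Rightarrow>\<^sub>L real. y z \<in> U} | z U. open (U :: real set)}"
  then obtain z U where V: "V = {y. blinfun_apply y z \<in> U}" "open U" by blast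
  have "openin T {x \<in> topspace T. f x z \<in> U}"
    using assms[of z] V(2) by (auto simp: continuous_map_def)
  also have "{x \<in> topspace T. f x z \<in> U} = f -` V \<inter> topspace T" using V(1) by auto
  finally show "openin T (f -` V \<inter> topspace T)" .
next
  show "f ` topspace T \<subseteq> \<Union> {{y :: 'b \<Rightarrow>\<^sub>L real. y z \<in> U} | z U. open (U :: real set)}"
    using topspace_weak_star[where 'a = 'b]
    unfolding weak_star_topology_def topology_generated_by_topspace by simp
qed

lemma continuous_map_weak_star_add:
  "continuous_map (prod_topology weak_star_topology weak_star_topology) weak_star_topology
     (\<lambda>(a, b). a + (b :: 'z::real_normed_vector \<Rightarrow>\<^sub>L real))"
proof (rule continuous_map_into_weak_star)
  fix z :: 'z
  let ?T = "prod_topology weak_star_topology (weak_star_topology :: ('z \<Rightarrow>\<^sub>L real) topology)"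
  have "continuous_map ?T euclideanreal (\<lambda>p. blinfun_apply (fst p) z + blinfun_apply (snd p) z)"
    using continuous_map_compose[OF continuous_map_fst continuous_map_weak_star_eval[of z]]
      continuous_map_compose[OF continuous_map_snd continuous_map_weak_star_eval[of z]]
    by (intro continuous_map_add) (simp_all add: o_def)
  then show "continuous_map ?T euclideanreal (\<lambda>p. blinfun_apply (case p of (a, b) \<Rightarrow> a + b) z)"
    by (simp add: case_prod_unfold blinfun.add_left)
qed

definition weak_star_ball ::
    "('a::real_normed_vector \<Rightarrow>\<^sub>L real) \<Rightarrow> 'a set \<Rightarrow> real \<Rightarrow> ('a \<Rightarrow>\<^sub>L real) set" where
  "weak_star_ball q F d = {y. \<forall>f\<in>F. \<bar>blinfun_apply y f - q f\<bar> < d}"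

lemma centre_in_weak_star_ball: "d > 0 \<Longrightarrow> q \<in> weak_star_ball q F d"
  by (simp add: weak_star_ball_def)

lemma openin_weak_star_ball:
  assumes "finite F"
  shows "openin weak_star_topology (weak_star_ball q F d)"
proof -
  have "openin weak_star_topology {y. \<bar>blinfun_apply y f - q f\<bar> < d}" for f
    using openin_weak_star_eval[of "ball (q f) d" f] by (simp add: dist_real_def abs_minus_commute)
  then have "openin weak_star_topology
      (topspace weak_star_topology \<inter> (\<Inter>f\<in>F. {y. \<bar>blinfun_apply y f - q f\<bar> < d}))"
    by (intro openin_Int_Inter assms finite_imageI openin_topspace) auto
  also have "topspace weak_star_topology \<inter> (\<Inter>f\<in>F. {y. \<bar>blinfun_apply y f - q f\<bar> < d}) =
      weak_star_ball q F d"
    by (auto simp: weak_star_ball_def)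
  finally show ?thesis .
qed

lemma openin_weak_star_imp_ball:
  fixes q :: "'a::real_normed_vector \<Rightarrow>\<^sub>L real"
  assumes "openin weak_star_topology U" "q \<in> U"
  obtains F d where "finite F" "d > 0" "weak_star_ball q F d \<subseteq> U"
proof -
  have "generate_topology_on {{y :: 'a \<Rightarrow>\<^sub>L real. y z \<in> V} | z V. open (V :: real set)} U"
    using assms(1) unfolding weak_star_topology_def by (rule openin_topology_generated_by)
  then have "\<exists>F d. finite F \<and> d > 0 \<and> weak_star_ball q F d \<subseteq> U" using assms(2)
  proof (induction rule: generate_topology_on.induct)
    case (Int U V)
    then obtain F d G e where "finite F" "d > 0" "weak_star_ball q F d \<subseteq> U"
      and "finite G" "e > 0" "weak_star_ball q G e \<subseteq> V"
      by auto
    then show ?case by (intro exI[of _ "F \<union> G"] exI[of _ "min d e"]) (auto simp: weak_star_ball_def)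
  next
    case (UN \<U>)
    then obtain U where U: "U \<in> \<U>" "q \<in> U" by blast
    with UN.IH[OF this] show ?case by (metis Sup_upper subset_trans)
  next
    case (Basis U)
    then obtain z V where U: "U = {y. blinfun_apply y z \<in> V}" "open V" by blast
    with Basis obtain d where d: "d > 0" "\<And>t. \<bar>t - q z\<bar> < d \<Longrightarrow> t \<in> V"
      unfolding open_dist dist_real_def by blast
    then show ?case
      unfolding U by (intro exI[of _ "{z}"] exI[of _ d]) (auto simp: weak_star_ball_def)
  qed simp
  with that show thesis by blast
qed

lemma in_weak_star_closure_of_iff:
  fixes q :: "'a::real_normed_vector \<Rightarrow>\<^sub>L real"
  shows "q \<in> weak_star_topology closure_of C \<longleftrightarrow>
    (\<forall>F d. finite F \<longrightarrow> 0 < d \<longrightarrow> C \<inter> weak_star_ball q F d \<noteq> {})"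
proof (intro iffI allI impI)
  fix F :: "'a set" and d :: real
  assume "q \<in> weak_star_topology closure_of C" "finite F" "0 < d"
  then show "C \<inter> weak_star_ball q F d \<noteq> {}"
    using openin_weak_star_ball[of F q d] centre_in_weak_star_ball[of d q F]
    unfolding in_closure_of by blast
next
  assume meets: "\<forall>F d. finite F \<longrightarrow> 0 < d \<longrightarrow> C \<inter> weak_star_ball q F d \<noteq> {}"
  have "\<exists>y. y \<in> C \<and> y \<in> U" if U: "openin weak_star_topology U" "q \<in> U" for U
  proof -
    obtain F d where "finite F" "d > 0" "weak_star_ball q F d \<subseteq> U"
      using U by (rule openin_weak_star_imp_ball)
    with meets show ?thesis by blast
  qed
  then show "q \<in> weak_star_topology closure_of C" by (simp add: in_closure_of)
qed

lemma limitin_weak_star_iff: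
  fixes y :: "'n \<Rightarrow> 'a::real_normed_vector \<Rightarrow>\<^sub>L real"
  shows "limitin weak_star_topology y q F \<longleftrightarrow> (\<forall>f. ((\<lambda>n. y n f) \<longlongrightarrow> q f) F)"
proof (intro iffI allI)
  show "((\<lambda>n. y n f) \<longlongrightarrow> q f) F" if "limitin weak_star_topology y q F" for f
    using continuous_map_limit[OF continuous_map_weak_star_eval that, of f] by (simp add: o_def)
next
  assume lim: "\<forall>f. ((\<lambda>n. y n f) \<longlongrightarrow> q f) F"
  have "\<forall>\<^sub>F n in F. y n \<in> U" if "openin weak_star_topology U" "q \<in> U" for U
  proof -
    obtain A d where A: "finite A" "d > 0" "weak_star_ball q A d \<subseteq> U"
      using \<open>openin _ U\<close> \<open>q \<in> U\<close> by (rule openin_weak_star_imp_ball)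
    have "\<forall>\<^sub>F n in F. \<bar>y n f - q f\<bar> < d" for f
      using tendstoD[OF lim[rule_format] A(2)] by (simp add: dist_real_def)
    then have "\<forall>\<^sub>F n in F. y n \<in> weak_star_ball q A d"
      using A(1) by (simp add: weak_star_ball_def eventually_ball_finite)
    then show ?thesis by (rule eventually_mono) (use A(3) in blast)
  qed
  then show "limitin weak_star_topology y q F" by (simp add: limitin_def)
qed

lemma weak_star_cluster_point_eval:
  fixes y :: "'n \<Rightarrow> 'a::real_normed_vector \<Rightarrow>\<^sub>L real"
  assumes "cluster_pointin weak_star_topology y q F" "((\<lambda>n. y n f) \<longlongrightarrow> l) F"
  shows "q f = l"
  using cluster_pointin_continuous_map[OF continuous_map_weak_star_eval assms(1), of f] assms(2)
  by (intro cluster_pointin_eq_limit[of euclideanreal]) (auto simp: o_def)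

lemma cluster_pointin_weak_star_diff:
  assumes "cluster_pointin weak_star_topology k q F"
  shows "cluster_pointin weak_star_topology (\<lambda>n. k n - c) (q - c) F"
proof -
  have "continuous_map weak_star_topology weak_star_topology (\<lambda>y :: 'a \<Rightarrow>\<^sub>L real. y - c)"
    by (intro continuous_map_into_weak_star)
      (simp add: blinfun.diff_left continuous_map_diff continuous_map_weak_star_eval)
  from cluster_pointin_continuous_map[OF this assms] show ?thesis by (simp add: o_def)
qed

lemma span_weak_star_cluster_points_eval_0:
  fixes y :: "'n \<Rightarrow> 'a::real_normed_vector \<Rightarrow>\<^sub>L real"
  assumes "z \<in> span {q. cluster_pointin weak_star_topology y q F}" and f: "((\<lambda>n. y n f) \<longlongrightarrow> 0) F"
  shows "z f = 0"
  using assms(1)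
proof (induction rule: span_induct_alt)
  case (step c q z)
  then have "q f = 0" using weak_star_cluster_point_eval[OF _ f] by blast
  with step show ?case by (simp add: blinfun.bilinear_simps)
qed (simp add: blinfun.zero_left)

section \<open>The canonical embedding into the bidual\<close>

definition ev :: "'a::real_normed_vector \<Rightarrow> ('a \<Rightarrow>\<^sub>L real) \<Rightarrow>\<^sub>L real" where
  "ev x = Blinfun (\<lambda>f. blinfun_apply f x)"

lemma ev_apply [simp]: "blinfun_apply (ev x) f = blinfun_apply f x"
  by (simp add: ev_def bounded_linear_Blinfun_apply blinfun.bounded_linear_left)

lemma norm_ev [simp]: "norm (ev x) = norm x"
proof (rule antisym)
  show "norm (ev x) \<le> norm x"
  proof (rule norm_blinfun_bound)
    show "norm (ev x f) \<le> norm x * norm f" for f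
      using norm_blinfun[of f x] by (simp add: mult.commute)
  qed simp
  obtain f :: "'a \<Rightarrow>\<^sub>L real" where f: "\<And>y. f y \<le> norm y" "f x = norm x"
    using hahn_banach_supporting_functional[OF sublinear_norm, of 1 x] by auto
  have "norm f \<le> 1"
    using f(1) f(1)[of "- _"]
    by (intro norm_blinfun_bound) (auto simp: abs_le_iff blinfun.minus_right)
  have "norm x = ev x f" using f(2) by simp
  also have "\<dots> \<le> norm (ev x) * norm f" using norm_blinfun[of "ev x" f] by simp
  also have "\<dots> \<le> norm (ev x)" using \<open>norm f \<le> 1\<close> by (simp add: mult_left_le)
  finally show "norm x \<le> norm (ev x)" .
qed

lemma bounded_linear_ev: "bounded_linear ev"
  by (rule bounded_linear_intro[of ev 1]) (auto intro!: blinfun_eqI simp: blinfun.bilinear_simps)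

lemmas linear_ev = bounded_linear.linear[OF bounded_linear_ev]

lemma subspace_range_ev: "subspace (range ev)"
  using linear_subspace_image[OF linear_ev subspace_UNIV] .

lemma closed_range_ev: "closed (range (ev :: 'a::banach \<Rightarrow> _))"
proof -
  have "complete (range (ev :: 'a \<Rightarrow> _))"
    by (rule complete_isometric_image[of 1]) (auto simp: bounded_linear_ev complete_UNIV)
  then show ?thesis by (rule complete_imp_closed)
qed

lemma norming_if_range_ev_subset:
  fixes Y :: "(('a::real_normed_vector \<Rightarrow>\<^sub>L real) \<Rightarrow>\<^sub>L real) set"
  assumes "range ev \<subseteq> Y"
  shows "norming Y"
  unfolding norming_def
proof (intro exI[of _ 1] conjI allI)
  fix f :: "'a \<Rightarrow>\<^sub>L real"
  define s where "s = Sup {blinfun_apply y f | y. y \<in> Y \<and> norm y \<le> 1}"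
  have "y f \<le> norm f" if "norm y \<le> 1" for y :: "('a \<Rightarrow>\<^sub>L real) \<Rightarrow>\<^sub>L real"
  proof -
    have "y f \<le> norm y * norm f" using norm_blinfun[of y f] by simp
    also have "\<dots> \<le> norm f" using that by (simp add: mult_left_le_one_le)
    finally show ?thesis .
  qed
  then have bdd: "bdd_above {blinfun_apply y f | y. y \<in> Y \<and> norm y \<le> 1}"
    by (intro bdd_aboveI) auto
  have f_le: "f x \<le> s" if "norm x \<le> 1" for x
  proof -
    have "ev x \<in> Y \<and> norm (ev x) \<le> 1" using that assms by auto
    then have "ev x f \<in> {blinfun_apply y f | y. y \<in> Y \<and> norm y \<le> 1}" by blast
    then show ?thesis unfolding s_def using cSup_upper[OF _ bdd] by fastforce
  qed
  have "norm f \<le> s"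
  proof (rule norm_blinfun_bound)
    show "0 \<le> s" using f_le[of 0] by (simp add: blinfun.zero_right)
    fix x show "norm (f x) \<le> s * norm x"
    proof (cases "x = 0")
      case False
      then have "f (x /\<^sub>R norm x) \<le> s" "f (- (x /\<^sub>R norm x)) \<le> s" by (auto intro!: f_le)
      with False show ?thesis by (simp add: blinfun.bilinear_simps abs_le_iff field_simps)
    qed (simp add: blinfun.zero_right)
  qed
  then show "1 * norm f \<le> s" by simp
qed simp

section \<open>Grothendieck's completeness theorem\<close>

lemma absolutely_convex_scale: "absolutely_convex K \<Longrightarrow> k \<in> K \<Longrightarrow> \<bar>c\<bar> \<le> 1 \<Longrightarrow> c *\<^sub>R k \<in> K"
  by (simp add: absolutely_convex_def)

lemma absolutely_convex_linear_image:
  assumes g: "linear g" and K: "absolutely_convex K"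
  shows "absolutely_convex (g ` K)"
  unfolding absolutely_convex_def
proof (intro conjI ballI allI impI)
  show "convex (g ` K)" using g K by (simp add: absolutely_convex_def convex_linear_image)
  fix y and c :: real assume "y \<in> g ` K" "\<bar>c\<bar> \<le> 1"
  then show "c *\<^sub>R y \<in> g ` K"
    using absolutely_convex_scale[OF K] by (auto simp flip: linear_scale[OF g])
qed

lemma absolutely_convex_Times:
  "absolutely_convex K \<Longrightarrow> absolutely_convex L \<Longrightarrow> absolutely_convex (K \<times> L)"
  by (auto simp: absolutely_convex_def convex_Times)

lemma mackey_sets_linear_image:
  assumes "compactin T K" "absolutely_convex K" "linear g" "continuous_map T weak_star_topology g"
    and "g ` K \<subseteq> Y"
  shows "g ` K \<in> mackey_sets Y"
  using assms by (simp add: mackey_sets_def absolutely_convex_linear_image image_compactin)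

lemma mackey_sets_segment:
  assumes "subspace Y" "y \<in> Y"
  shows "(\<lambda>t. t *\<^sub>R y) ` {-1..1::real} \<in> mackey_sets Y"
proof (rule mackey_sets_linear_image)
  show "absolutely_convex {-1..1::real}"
    unfolding absolutely_convex_def
  proof (intro conjI ballI allI impI)
    fix t a :: real assume "t \<in> {-1..1}" "\<bar>a\<bar> \<le> 1"
    then have "\<bar>a * t\<bar> \<le> 1" by (simp add: abs_mult mult_le_one abs_le_iff)
    then show "a *\<^sub>R t \<in> {-1..1}" by (simp add: abs_le_iff)
  qed simp
  show "linear (\<lambda>t. t *\<^sub>R y)" by (rule linear_scale_left)
  show "continuous_map euclideanreal weak_star_topology (\<lambda>t. t *\<^sub>R y)"
    by (rule continuous_map_into_weak_star)
      (auto simp: blinfun.scaleR_left intro!: continuous_intros)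
  show "(\<lambda>t. t *\<^sub>R y) ` {-1..1} \<subseteq> Y" using assms by (auto intro: subspace_scale)
qed simp

lemma mackey_sets_sum:
  assumes "subspace Y" "K \<in> mackey_sets Y" "L \<in> mackey_sets Y"
  shows "(\<lambda>(a, b). a + b) ` (K \<times> L) \<in> mackey_sets Y"
proof (rule mackey_sets_linear_image[OF _ _ _ continuous_map_weak_star_add])
  show "linear (\<lambda>(a, b). a + b :: 'a \<Rightarrow>\<^sub>L real)"
    by (rule linearI) (auto simp: scaleR_add_right)
  show "(\<lambda>(a, b). a + b) ` (K \<times> L) \<subseteq> Y"
    using assms by (auto simp: mackey_sets_def intro: subspace_add)
qed (use assms in \<open>auto simp: mackey_sets_def compactin_Times absolutely_convex_Times\<close>)

lemma mackey_sets_directed: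
  assumes "subspace Y" "K \<in> mackey_sets Y" "L \<in> mackey_sets Y"
  shows "\<exists>M\<in>mackey_sets Y. K \<union> L \<subseteq> M"
proof (cases "K = {} \<or> L = {}")
  case True
  with assms(2,3) show ?thesis by auto
next
  case False
  have "0 \<in> M" if "M \<in> mackey_sets Y" "M \<noteq> {}" for M
  proof -
    obtain m where "m \<in> M" using \<open>M \<noteq> {}\<close> by blast
    with \<open>M \<in> _\<close> show ?thesis using absolutely_convex_scale[of M m 0] by (simp add: mackey_sets_def)
  qed
  with False assms(2,3) have "0 \<in> K" "0 \<in> L" by auto
  then have "K \<union> L \<subseteq> (\<lambda>(a, b). a + b) ` (K \<times> L)" by force
  with mackey_sets_sum[OF assms] show ?thesis by blast
qed

lemma linear_functional_in_span:
  fixes v :: "'v::real_vector \<Rightarrow> real"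
  assumes "finite F" "\<And>f. f \<in> F \<Longrightarrow> linear (\<phi> f)" "linear v"
    and "\<And>y. (\<And>f. f \<in> F \<Longrightarrow> \<phi> f y = 0) \<Longrightarrow> v y = 0"
  shows "\<exists>c. \<forall>y. v y = (\<Sum>f\<in>F. c f * \<phi> f y)"
  using assms
proof (induction F arbitrary: v rule: finite_induct)
  case (insert g F)
  have lin: "linear (\<phi> g)" "linear v" using insert.prems by auto
  obtain a where a: "\<And>y. (\<And>f. f \<in> F \<Longrightarrow> \<phi> f y = 0) \<Longrightarrow> v y - a * \<phi> g y = 0"
  proof (cases "\<forall>y. (\<forall>f\<in>F. \<phi> f y = 0) \<longrightarrow> \<phi> g y = 0")
    case True
    with insert.prems(3) show ?thesis by (intro that[of 0]) auto
  next
    case False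
    then obtain x where x: "\<And>f. f \<in> F \<Longrightarrow> \<phi> f x = 0" "\<phi> g x \<noteq> 0" by auto
    show ?thesis
    proof (rule that)
      fix y assume y: "\<And>f. f \<in> F \<Longrightarrow> \<phi> f y = 0"
      define w where "w = y - (\<phi> g y / \<phi> g x) *\<^sub>R x"
      have "\<phi> f w = 0" if "f \<in> insert g F" for f
        using insert.prems(1)[OF that] that x y by (auto simp: w_def linear_diff linear_scale)
      then have "v w = 0" by (rule insert.prems(3))
      then show "v y - v x / \<phi> g x * \<phi> g y = 0"
        using lin(2) by (simp add: w_def linear_diff linear_scale)
    qed
  qed
  have "linear (\<lambda>y. v y - a * \<phi> g y)"
    using lin by (intro linearI) (auto simp: linear_add linear_scale algebra_simps)
  with a insert.prems(1) have "\<exists>c. \<forall>y. v y - a * \<phi> g y = (\<Sum>f\<in>F. c f * \<phi> f y)"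
    by (intro insert.IH) auto
  then obtain c where "\<And>y. v y = a * \<phi> g y + (\<Sum>f\<in>F. c f * \<phi> f y)" by (auto simp: algebra_simps)
  then have "v y = (\<Sum>f\<in>insert g F. (c(g := a)) f * \<phi> f y)" for y
    using insert.hyps by (auto intro!: sum.cong)
  then show ?case by blast
qed simp

lemma sublinear_sum_abs_eval: "0 \<le> c \<Longrightarrow> sublinear (\<lambda>y. c * (\<Sum>f\<in>F. \<bar>blinfun_apply y f\<bar>))"
proof (rule sublinearI)
  fix x y :: "'a \<Rightarrow>\<^sub>L real" assume "0 \<le> c"
  have "(\<Sum>f\<in>F. \<bar>(x + y) f\<bar>) \<le> (\<Sum>f\<in>F. \<bar>x f\<bar>) + (\<Sum>f\<in>F. \<bar>y f\<bar>)"
    by (auto simp: blinfun.add_left abs_triangle_ineq simp flip: sum.distrib intro: sum_mono)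
  with \<open>0 \<le> c\<close> show "c * (\<Sum>f\<in>F. \<bar>(x + y) f\<bar>) \<le> c * (\<Sum>f\<in>F. \<bar>x f\<bar>) + c * (\<Sum>f\<in>F. \<bar>y f\<bar>)"
    by (simp add: mult_left_mono flip: distrib_left)
qed (simp add: blinfun.scaleR_left abs_mult flip: sum_distrib_left)

lemma linear_functional_le_sum_abs_eval:
  fixes v :: "('z::real_normed_vector \<Rightarrow>\<^sub>L real) \<Rightarrow> real"
  assumes "finite F" and v: "linear v" and le: "\<And>y. v y \<le> c * (\<Sum>f\<in>F. \<bar>blinfun_apply y f\<bar>)"
  shows "\<exists>z. \<forall>y. v y = blinfun_apply y z"
proof -
  have "v y = 0" if "\<And>f. f \<in> F \<Longrightarrow> y f = 0" for y :: "'z \<Rightarrow>\<^sub>L real"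
    using le[of y] le[of "- y"] that linear_neg[OF v, of y] by (simp add: blinfun.minus_left)
  moreover have "linear (\<lambda>y :: 'z \<Rightarrow>\<^sub>L real. y f)" for f
    by (rule bounded_linear.linear[OF blinfun.bounded_linear_left])
  ultimately obtain a where "\<And>y. v y = (\<Sum>f\<in>F. a f * blinfun_apply y f)"
    using linear_functional_in_span[OF assms(1) _ v, of "\<lambda>f y. blinfun_apply y f"] by blast
  then have "v y = blinfun_apply y (\<Sum>f\<in>F. a f *\<^sub>R f)" for y by (simp add: blinfun.bilinear_simps)
  then show ?thesis by blast
qed

lemma linear_le_sublinear_if_level_le:
  fixes h :: "'v::real_vector \<Rightarrow> real"
  assumes h: "linear h" and K: "absolutely_convex K" and P: "sublinear P" and e: "e > 0"
    and nonneg: "0 \<le> P k" and level: "\<And>k. k \<in> K \<Longrightarrow> h k = e \<Longrightarrow> e \<le> P k" and k: "k \<in> K"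
  shows "h k - e \<le> P k"
proof (cases "h k \<le> e")
  case True
  with nonneg show ?thesis by linarith
next
  case False
  define c where "c = e / h k"
  have c: "0 < c" "c \<le> 1" using False e by (auto simp: c_def)
  have "c *\<^sub>R k \<in> K" using absolutely_convex_scale[OF K k] c by simp
  moreover have "h (c *\<^sub>R k) = e" using False e by (simp add: c_def linear_scale[OF h])
  ultimately have "e \<le> c * P k" using level[of "c *\<^sub>R k"] c sublinear_scale[OF P, of c k] by simp
  then have "h k \<le> P k" using False e by (simp add: c_def field_simps)
  with e show ?thesis by simp
qed

definition uniform_approximants ::
    "(('z::real_normed_vector \<Rightarrow>\<^sub>L real) \<Rightarrow> real) \<Rightarrow> ('z \<Rightarrow>\<^sub>L real) set \<Rightarrow> real \<Rightarrow> 'z set" where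
  "uniform_approximants h K e = {z. \<forall>k\<in>K. \<bar>blinfun_apply k z - h k\<bar> \<le> e}"

lemma uniform_approximants_nonempty:
  fixes h :: "('z::real_normed_vector \<Rightarrow>\<^sub>L real) \<Rightarrow> real"
  assumes h: "linear h" and K: "absolutely_convex K" and e: "e > 0"
    and not_closure: "0 \<notin> weak_star_topology closure_of {k \<in> K. h k = e}"
  shows "uniform_approximants h K e \<noteq> {}"
proof (cases "K = {}")
  case False
  obtain F d where F: "finite F" "d > 0"
    and disjoint: "{k \<in> K. h k = e} \<inter> weak_star_ball 0 F d = {}"
    using not_closure unfolding in_weak_star_closure_of_iff by blast
  define P where "P k = e / d * (\<Sum>f\<in>F. \<bar>k f\<bar>)" for k :: "'z \<Rightarrow>\<^sub>L real"
  have P: "sublinear P" unfolding P_def using e F by (intro sublinear_sum_abs_eval) simp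
  have level_ge: "e \<le> P k" if k: "k \<in> K" "h k = e" for k
  proof -
    obtain f where f: "f \<in> F" "d \<le> \<bar>k f\<bar>"
      using disjoint k unfolding weak_star_ball_def by force
    then have "d \<le> (\<Sum>f\<in>F. \<bar>k f\<bar>)" using member_le_sum[of f F "\<lambda>f. \<bar>k f\<bar>"] F(1) by auto
    then show ?thesis using e F(2) by (simp add: P_def field_simps)
  qed
  have "0 \<le> P k" for k using e F by (simp add: P_def sum_nonneg)
  then have "h k - e \<le> P k" if "k \<in> K" for k
    using linear_le_sublinear_if_level_le[OF h K P e] level_ge that by blast
  moreover have "concave_on K (\<lambda>k. h k - e)"
    using K h unfolding concave_on_iff absolutely_convex_def
    by (auto simp: linear_add linear_scale algebra_simps simp flip: distrib_right)
  ultimately obtain v where v: "linear v" "\<And>y. v y \<le> P y" "\<And>k. k \<in> K \<Longrightarrow> h k - e \<le> v k"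
    using mazur_orlicz[OF P False] by blast
  obtain z where z: "\<And>y. v y = blinfun_apply y z"
    using linear_functional_le_sum_abs_eval[OF F(1) v(1) v(2)[unfolded P_def]] by blast
  have "\<bar>blinfun_apply k z - h k\<bar> \<le> e" if k: "k \<in> K" for k
  proof -
    have "- k \<in> K" using absolutely_convex_scale[OF K k, of "-1"] by simp
    from v(3)[OF k] v(3)[OF this] show ?thesis
      unfolding z by (simp add: linear_neg[OF h] blinfun.minus_left abs_le_iff)
  qed
  then show ?thesis by (auto simp: uniform_approximants_def)
qed (simp add: uniform_approximants_def)

definition approximation_filter ::
    "('z::real_normed_vector \<Rightarrow>\<^sub>L real) set \<Rightarrow> (('z \<Rightarrow>\<^sub>L real) \<Rightarrow> real) \<Rightarrow> 'z filter" where
  "approximation_filter Y h =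
     (INF (K, e)\<in>mackey_sets Y \<times> {0<..}. principal (uniform_approximants h K e))"

lemma eventually_approximation_filter:
  assumes Y: "subspace Y"
  shows "eventually P (approximation_filter Y h) \<longleftrightarrow>
    (\<exists>K\<in>mackey_sets Y. \<exists>e>0. \<forall>z\<in>uniform_approximants h K e. P z)"
proof -
  define G where "G = (\<lambda>(K, e). principal (uniform_approximants h K e))"
  have "{} \<in> mackey_sets Y" by (simp add: mackey_sets_def absolutely_convex_def)
  then have "mackey_sets Y \<times> {0::real<..} \<noteq> {}" using zero_less_one by blast
  moreover have "\<exists>l\<in>mackey_sets Y \<times> {0<..}. G l \<le> inf (G i) (G j)"
    if ij: "i \<in> mackey_sets Y \<times> {0<..}" "j \<in> mackey_sets Y \<times> {0<..}" for i j
  proof -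
    obtain K d L e where i: "i = (K, d)" "j = (L, e)" by fastforce
    with ij have KL: "K \<in> mackey_sets Y" "L \<in> mackey_sets Y" and de: "0 < d" "0 < e" by auto
    obtain M where M: "M \<in> mackey_sets Y" "K \<union> L \<subseteq> M" using mackey_sets_directed[OF Y KL] by blast
    then have "G (M, min d e) \<le> inf (G i) (G j)"
      by (auto simp: G_def i uniform_approximants_def)
    with M(1) de show ?thesis by (intro bexI[of _ "(M, min d e)"]) auto
  qed
  ultimately have "eventually P (INF i\<in>mackey_sets Y \<times> {0<..}. G i) \<longleftrightarrow>
      (\<exists>i\<in>mackey_sets Y \<times> {0<..}. eventually P (G i))"
    by (rule eventually_INF_base)
  then show ?thesis by (auto simp: approximation_filter_def G_def eventually_principal)
qed

lemma eventually_in_uniform_approximants: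
  assumes "subspace Y" "K \<in> mackey_sets Y" "e > 0"
  shows "\<forall>\<^sub>F z in approximation_filter Y h. z \<in> uniform_approximants h K e"
  using assms by (auto simp: eventually_approximation_filter)

lemma mackey_cauchy_approximation_filter:
  assumes Y: "subspace Y"
  shows "mackey_cauchy Y (approximation_filter Y h)"
  unfolding mackey_cauchy_def
proof (intro ballI allI impI)
  fix K and e :: real assume K: "K \<in> mackey_sets Y" and e: "e > 0"
  define A where "A = uniform_approximants h K (e / 2)"
  have "\<forall>\<^sub>F z in approximation_filter Y h. z \<in> A"
    unfolding A_def using Y K e by (intro eventually_in_uniform_approximants) auto
  moreover have "\<bar>blinfun_apply k a - blinfun_apply k b\<bar> \<le> e" if "a \<in> A" "b \<in> A" "k \<in> K" for a b k
  proof -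
    have "\<bar>blinfun_apply k a - h k\<bar> \<le> e / 2" "\<bar>blinfun_apply k b - h k\<bar> \<le> e / 2"
      using that by (auto simp: A_def uniform_approximants_def)
    then show ?thesis by linarith
  qed
  ultimately show "\<forall>\<^sub>F (a, b) in approximation_filter Y h \<times>\<^sub>F approximation_filter Y h.
      \<forall>k\<in>K. \<bar>blinfun_apply k a - blinfun_apply k b\<bar> \<le> e"
    unfolding eventually_prod_filter by (intro exI[of _ "\<lambda>z. z \<in> A"]) auto
qed

lemma approximation_filter_limit:
  assumes Y: "subspace Y" and nontrivial: "approximation_filter Y h \<noteq> bot"
    and z: "mackey_converges Y (approximation_filter Y h) z" and y: "y \<in> Y"
  shows "blinfun_apply y z = h y"
proof -
  define S where "S = (\<lambda>t. t *\<^sub>R y) ` {-1..1::real}"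
  have S: "S \<in> mackey_sets Y" "y \<in> S"
    using mackey_sets_segment[OF Y y] by (auto simp: S_def intro!: image_eqI[of _ _ 1])
  have "\<bar>blinfun_apply y z - h y\<bar> \<le> 0 + e" if e: "e > 0" for e
  proof -
    have "\<forall>\<^sub>F a in approximation_filter Y h. \<forall>y\<in>S. \<bar>blinfun_apply y a - blinfun_apply y z\<bar> \<le> e / 2"
      using z S(1) e unfolding mackey_converges_def by (meson half_gt_zero)
    moreover have "\<forall>\<^sub>F a in approximation_filter Y h. a \<in> uniform_approximants h S (e / 2)"
      using Y S(1) e by (intro eventually_in_uniform_approximants) auto
    ultimately have "\<forall>\<^sub>F a in approximation_filter Y h. \<bar>blinfun_apply y z - h y\<bar> \<le> e"
    proof eventually_elim
      case (elim a)
      then have "\<bar>blinfun_apply y a - blinfun_apply y z\<bar> \<le> e / 2"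
        "\<bar>blinfun_apply y a - h y\<bar> \<le> e / 2"
        using S(2) by (auto simp: uniform_approximants_def)
      then show ?case by linarith
    qed
    with nontrivial show ?thesis by simp
  qed
  then have "\<bar>blinfun_apply y z - h y\<bar> \<le> 0" by (rule field_le_epsilon)
  then show ?thesis by simp
qed

text \<open>As \<open>K\<close> is balanced, the hypothesis says that the restriction of \<open>h\<close> to \<open>K\<close> is
  \<open>w*\<close>-continuous at \<open>0\<close>.\<close>
theorem grothendieck_completeness:
  fixes h :: "('z::real_normed_vector \<Rightarrow>\<^sub>L real) \<Rightarrow> real"
  assumes Y: "subspace Y" "mackey_complete Y" and h: "linear h"
    and continuous: "\<And>K e. K \<in> mackey_sets Y \<Longrightarrow> e > 0 \<Longrightarrow>
      0 \<notin> weak_star_topology closure_of {k \<in> K. h k = e}"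
  shows "\<exists>z. \<forall>y\<in>Y. blinfun_apply y z = h y"
proof -
  have "uniform_approximants h K e \<noteq> {}" if "K \<in> mackey_sets Y" "e > 0" for K e
    using h that continuous by (intro uniform_approximants_nonempty) (auto simp: mackey_sets_def)
  then have nontrivial: "approximation_filter Y h \<noteq> bot"
    unfolding trivial_limit_def[of "approximation_filter Y h"]
      eventually_approximation_filter[OF Y(1)] by blast
  then obtain z where "mackey_converges Y (approximation_filter Y h) z"
    using Y mackey_cauchy_approximation_filter unfolding mackey_complete_def by blast
  with Y(1) nontrivial show ?thesis by (blast intro: approximation_filter_limit)
qed

section \<open>Whitley sequences\<close>

lemma almost_norm_attaining:
  fixes y :: "'z::real_normed_vector \<Rightarrow>\<^sub>L real"
  assumes "c < 1"
  shows "\<exists>f. norm f \<le> 1 \<and> c * norm y \<le> \<bar>y f\<bar>"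
proof (rule ccontr)
  assume "\<nexists>f. norm f \<le> 1 \<and> c * norm y \<le> \<bar>y f\<bar>"
  then have less: "\<bar>y f\<bar> < c * norm y" if "norm f \<le> 1" for f using that by force
  have pos: "0 < c * norm y" using less[of 0] by (simp add: blinfun.zero_right)
  have "norm y \<le> c * norm y"
  proof (rule norm_blinfun_bound)
    fix f show "norm (y f) \<le> c * norm y * norm f"
    proof (cases "f = 0")
      case False
      then have "\<bar>y (f /\<^sub>R norm f)\<bar> < c * norm y" by (intro less) simp
      with False show ?thesis by (simp add: blinfun.scaleR_right abs_mult field_simps)
    qed (simp add: blinfun.zero_right)
  qed (use pos in simp)
  moreover have "0 < norm y" using pos by (auto simp: zero_less_mult_iff)
  ultimately show False using assms by simp
qed

lemma vanishing_on_norming_family_imp_0: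
  fixes z :: "'z::real_normed_vector \<Rightarrow>\<^sub>L real"
  assumes z: "z \<in> closure U" and "0 \<le> c"
    and g: "\<And>y. y \<in> U \<Longrightarrow> norm (g y) \<le> 1" "\<And>y. y \<in> U \<Longrightarrow> norm y \<le> c * \<bar>blinfun_apply y (g y)\<bar>"
    and vanishes: "\<And>y. y \<in> U \<Longrightarrow> z (g y) = 0"
  shows "z = 0"
proof -
  obtain y where y: "\<And>n. y n \<in> U" "y \<longlonglongrightarrow> z" using z unfolding closure_sequential by blast
  have "norm (y n) \<le> c * norm (y n - z)" for n
  proof -
    have "\<bar>y n (g (y n))\<bar> = \<bar>(y n - z) (g (y n))\<bar>"
      using vanishes[OF y(1)] by (simp add: blinfun.diff_left)
    also have "\<dots> \<le> norm (y n - z) * norm (g (y n))"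
      using norm_blinfun[of "y n - z" "g (y n)"] by simp
    also have "\<dots> \<le> norm (y n - z)" using g(1)[OF y(1)] by (simp add: mult_left_le)
    finally show ?thesis using g(2)[OF y(1), of n] \<open>0 \<le> c\<close> by (meson mult_left_mono order_trans)
  qed
  moreover have "(\<lambda>n. norm (y n)) \<longlonglongrightarrow> norm z" using y(2) by (rule tendsto_norm)
  moreover have "(\<lambda>n. c * norm (y n - z)) \<longlonglongrightarrow> c * norm (z - z)" by (intro tendsto_intros y(2))
  ultimately have "norm z \<le> c * norm (z - z)" by (meson LIMSEQ_le)
  then show ?thesis by simp
qed

lemma separable_span_finite:
  fixes B :: "'v::real_normed_vector set"
  assumes "finite B"
  shows "\<exists>D. countable D \<and> D \<subseteq> span B \<and> span B \<subseteq> closure D"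
  using assms
proof (induction B rule: finite_induct)
  case empty
  then show ?case by (intro exI[of _ "{0}"]) simp
next
  case (insert b B)
  then obtain D where D: "countable D" "D \<subseteq> span B" "span B \<subseteq> closure D" by blast
  define D' where "D' = (\<lambda>(d, q). d + q *\<^sub>R b) ` (D \<times> \<rat>)"
  have "countable D'"
    unfolding D'_def using D(1) countable_rat by (intro countable_image countable_SIGMA) auto
  moreover have "D' \<subseteq> span (insert b B)"
  proof -
    have "d \<in> span (insert b B)" if "d \<in> D" for d
      using that D(2) span_mono[OF subset_insertI, of B b] by blast
    then show ?thesis by (auto simp: D'_def intro: span_add span_scale span_base)
  qed
  moreover have "x \<in> closure D'" if "x \<in> span (insert b B)" for x
  proof -
    obtain c where "x - c *\<^sub>R b \<in> closure D" using \<open>x \<in> _\<close> D(3) unfolding span_insert by blast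
    then obtain d where d: "\<And>n. d n \<in> D" "d \<longlonglongrightarrow> x - c *\<^sub>R b" unfolding closure_sequential by blast
    have "c \<in> closure \<rat>" by (simp add: Rats_closure_real)
    then obtain q :: "nat \<Rightarrow> real" where q: "\<And>n. q n \<in> \<rat>" "q \<longlonglongrightarrow> c"
      unfolding closure_sequential by blast
    have "(\<lambda>n. d n + q n *\<^sub>R b) \<longlonglongrightarrow> (x - c *\<^sub>R b) + c *\<^sub>R b"
      using d(2) q(2) by (intro tendsto_intros)
    moreover have "d n + q n *\<^sub>R b \<in> D'" for n using d(1) q(1) unfolding D'_def by force
    ultimately show ?thesis
      unfolding closure_sequential by (intro exI[of _ "\<lambda>n. d n + q n *\<^sub>R b"]) simp
  qed
  ultimately show ?case by blast
qed

lemma closure_span_range_subset: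
  fixes k :: "nat \<Rightarrow> 'v::real_normed_vector"
  assumes "\<And>n. span (k ` {..<n}) \<subseteq> closure (D n)"
  shows "closure (span (range k)) \<subseteq> closure (\<Union>n. D n)"
proof (rule closure_minimal)
  show "span (range k) \<subseteq> closure (\<Union>n. D n)"
  proof
    fix x assume "x \<in> span (range k)"
    then obtain t r where t: "finite t" "t \<subseteq> range k" "x = (\<Sum>a\<in>t. r a *\<^sub>R a)"
      unfolding span_explicit by blast
    obtain I where I: "finite I" "t = k ` I" using finite_subset_image[OF t(1,2)] by blast
    then obtain n where "I \<subseteq> {..<n}" using finite_nat_iff_bounded by blast
    then have "x \<in> span (k ` {..<n})"
      unfolding t(3) I(2) by (intro span_sum span_scale span_base) auto
    also have "\<dots> \<subseteq> closure (D n)" by (rule assms)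
    also have "\<dots> \<subseteq> closure (\<Union>n. D n)" by (intro closure_mono) auto
    finally show "x \<in> closure (\<Union>n. D n)" .
  qed
qed simp

lemma weak_star_sequence_null_on_history:
  fixes C :: "('z::real_normed_vector \<Rightarrow>\<^sub>L real) set" and N :: "('z \<Rightarrow>\<^sub>L real) set \<Rightarrow> 'z set"
  assumes C: "0 \<in> weak_star_topology closure_of C" and N: "\<And>B. finite B \<Longrightarrow> countable (N B)"
  obtains k where "\<And>n. k n \<in> C" "\<And>i f. f \<in> N (k ` {..<i}) \<Longrightarrow> (\<lambda>n. k n f) \<longlonglongrightarrow> 0"
proof -
  define test where "test k i j = from_nat_into (N (k ` {..<i})) j" for k and i j :: nat
  define P where "P k n r \<longleftrightarrow> r \<in> C \<and> (\<forall>i\<le>n. \<forall>j\<le>n. \<bar>r (test k i j)\<bar> < inverse (real (Suc n)))"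
    for k n and r :: "'z \<Rightarrow>\<^sub>L real"
  have "\<exists>k. \<forall>n. P k n (k n)"
  proof (rule dependent_wellorder_choice)
    fix r :: "'z \<Rightarrow>\<^sub>L real" and k l :: "nat \<Rightarrow> 'z \<Rightarrow>\<^sub>L real" and n
    assume "\<And>m. m < n \<Longrightarrow> k m = l m"
    then have "k ` {..<i} = l ` {..<i}" if "i \<le> n" for i using that by (intro image_cong) auto
    then show "P k n r = P l n r" by (simp add: P_def test_def)
  next
    fix n and k :: "nat \<Rightarrow> 'z \<Rightarrow>\<^sub>L real"
    define F where "F = (\<lambda>(i, j). test k i j) ` ({..n} \<times> {..n})"
    have "C \<inter> weak_star_ball 0 F (inverse (real (Suc n))) \<noteq> {}"
      using C unfolding in_weak_star_closure_of_iff by (simp add: F_def)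
    then show "\<exists>r. P k n r" by (auto simp: P_def F_def weak_star_ball_def)
  qed
  then obtain k where k: "\<And>n. P k n (k n)" by blast
  show thesis
  proof (rule that)
    show "k n \<in> C" for n using k[of n] by (simp add: P_def)
    fix i f assume f: "f \<in> N (k ` {..<i})"
    have "countable (N (k ` {..<i}))" by (rule N) simp
    then obtain j where j: "test k i j = f"
      using from_nat_into_surj[OF _ f] unfolding test_def by blast
    have "\<forall>\<^sub>F n in sequentially. norm (k n f) \<le> inverse (real (Suc n))"
      using eventually_ge_at_top[of "max i j"]
    proof eventually_elim
      case (elim n)
      then show ?case using k[of n] by (force simp: P_def j[symmetric])
    qed
    then show "(\<lambda>n. k n f) \<longlonglongrightarrow> 0" by (rule Lim_null_comparison[OF _ LIMSEQ_inverse_real_of_nat])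
  qed
qed

definition whitley_sequence :: "(nat \<Rightarrow> 'z::real_normed_vector \<Rightarrow>\<^sub>L real) \<Rightarrow> bool" where
  "whitley_sequence k \<longleftrightarrow>
     closure (span (range k)) \<inter> span {q. cluster_pointin weak_star_topology k q sequentially} \<subseteq> {0}"

theorem whitley_sequence_exists:
  fixes C :: "('z::real_normed_vector \<Rightarrow>\<^sub>L real) set"
  assumes "0 \<in> weak_star_topology closure_of C"
  obtains k where "whitley_sequence k" "\<And>n. k n \<in> C"
proof -
  have "\<exists>f. norm f \<le> 1 \<and> norm y \<le> 2 * \<bar>y f\<bar>" for y :: "'z \<Rightarrow>\<^sub>L real"
    using almost_norm_attaining[of "1/2" y] by (auto simp: field_simps)
  then obtain g where g: "\<And>y :: 'z \<Rightarrow>\<^sub>L real. norm (g y) \<le> 1"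
    "\<And>y :: 'z \<Rightarrow>\<^sub>L real. norm y \<le> 2 * \<bar>y (g y)\<bar>"
    by metis
  obtain D :: "('z \<Rightarrow>\<^sub>L real) set \<Rightarrow> ('z \<Rightarrow>\<^sub>L real) set"
    where D: "\<And>B. finite B \<Longrightarrow> countable (D B)" "\<And>B. finite B \<Longrightarrow> span B \<subseteq> closure (D B)"
    using separable_span_finite by metis
  obtain k where kC: "\<And>n. k n \<in> C"
    and null: "\<And>i f. f \<in> g ` D (k ` {..<i}) \<Longrightarrow> (\<lambda>n. k n f) \<longlonglongrightarrow> 0"
    using weak_star_sequence_null_on_history[OF assms, of "\<lambda>B. g ` D B"] D(1) by auto
  have "z = 0"
    if z: "z \<in> closure (span (range k))"
      "z \<in> span {q. cluster_pointin weak_star_topology k q sequentially}" for z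
  proof (rule vanishing_on_norming_family_imp_0[OF _ _ g])
    show "z \<in> closure (\<Union>n. D (k ` {..<n}))"
      using closure_span_range_subset[of k "\<lambda>n. D (k ` {..<n})"] D(2) z(1) by blast
    show "z (g y) = 0" if "y \<in> (\<Union>n. D (k ` {..<n}))" for y
      using that by (intro span_weak_star_cluster_points_eval_0[OF z(2)]) (auto intro: null)
  qed simp
  then have "whitley_sequence k" unfolding whitley_sequence_def by blast
  from this kC show thesis by (rule that)
qed

section \<open>Elements of the bidual of the first Baire class\<close>

definition baire_one :: "(('a::real_normed_vector \<Rightarrow>\<^sub>L real) \<Rightarrow>\<^sub>L real) set" where
  "baire_one = {\<phi>. \<exists>x. limitin weak_star_topology (\<lambda>n. ev (x n)) \<phi> sequentially}"

lemma range_ev_subset_baire_one: "range ev \<subseteq> baire_one"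
proof (rule image_subsetI)
  show "ev x \<in> baire_one" for x
    unfolding baire_one_def by (intro CollectI exI[of _ "\<lambda>_. x"]) simp
qed

lemma subspace_baire_one: "subspace baire_one"
proof (rule subspaceI)
  show "0 \<in> baire_one" using range_ev_subset_baire_one subspace_0[OF subspace_range_ev] by blast
next
  fix \<phi> \<psi> :: "('a \<Rightarrow>\<^sub>L real) \<Rightarrow>\<^sub>L real" assume "\<phi> \<in> baire_one" "\<psi> \<in> baire_one"
  then obtain x y :: "nat \<Rightarrow> 'a" where "\<And>f. (\<lambda>n. blinfun_apply f (x n)) \<longlonglongrightarrow> \<phi> f"
    "\<And>f. (\<lambda>n. blinfun_apply f (y n)) \<longlonglongrightarrow> \<psi> f"
    by (auto simp: baire_one_def limitin_weak_star_iff)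
  then show "\<phi> + \<psi> \<in> baire_one"
    unfolding baire_one_def limitin_weak_star_iff
    by (intro CollectI exI[of _ "\<lambda>n. x n + y n"]) (simp add: blinfun.bilinear_simps tendsto_add)
next
  fix c and \<phi> :: "('a \<Rightarrow>\<^sub>L real) \<Rightarrow>\<^sub>L real" assume "\<phi> \<in> baire_one"
  then obtain x :: "nat \<Rightarrow> 'a" where "\<And>f. (\<lambda>n. blinfun_apply f (x n)) \<longlonglongrightarrow> \<phi> f"
    by (auto simp: baire_one_def limitin_weak_star_iff)
  then show "c *\<^sub>R \<phi> \<in> baire_one"
    unfolding baire_one_def limitin_weak_star_iff
    by (intro CollectI exI[of _ "\<lambda>n. c *\<^sub>R x n"])
      (simp add: blinfun.bilinear_simps tendsto_mult_left)
qed

section \<open>One-dimensional extensions of a space in its bidual\<close>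

lemma in_closure_span_if_ev_in_span_cluster_points:
  assumes "ev y \<in> span {q. cluster_pointin weak_star_topology (\<lambda>n. ev (x n)) q F}"
  shows "y \<in> closure (span (range x))"
proof (rule in_closure_span_if_annihilated)
  fix f :: "'a \<Rightarrow>\<^sub>L real" assume "\<And>a. a \<in> range x \<Longrightarrow> f a = 0"
  then have "((\<lambda>n. ev (x n) f) \<longlongrightarrow> 0) F" by simp
  with assms have "ev y f = 0" by (rule span_weak_star_cluster_points_eval_0)
  then show "f y = 0" by simp
qed

lemma ev_closure_span: "y \<in> closure (span A) \<Longrightarrow> ev y \<in> closure (span (ev ` A))"
  using closure_bounded_linear_image_subset[OF bounded_linear_ev, of "span A"]
  by (auto simp: linear_span_image[OF linear_ev])

locale whitley_level_sequence =
  fixes E :: "(('a::real_normed_vector \<Rightarrow>\<^sub>L real) \<Rightarrow>\<^sub>L real) set" and h :: "_ \<Rightarrow> real"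
    and k :: "nat \<Rightarrow> ('a \<Rightarrow>\<^sub>L real) \<Rightarrow>\<^sub>L real" and e :: real
  assumes E: "subspace E" and h: "linear h" and ker_h: "\<And>y. y \<in> E \<Longrightarrow> h y = 0 \<Longrightarrow> y \<in> range ev"
    and k: "\<And>n. k n \<in> E" "\<And>n. h (k n) = e" and e: "e \<noteq> 0"
    and whitley: "whitley_sequence k"
begin

lemma differences_in_range_ev: "\<exists>x. \<forall>n. k n - k 0 = ev (x n)"
proof -
  have "k n - k 0 \<in> range ev" for n
    using k by (intro ker_h subspace_diff[OF E]) (simp_all add: linear_diff[OF h])
  then have "\<forall>n. \<exists>x. k n - k 0 = ev x" by blast
  then show ?thesis by (rule choice)
qed

lemma cluster_combination_eq_0:
  assumes u: "u \<in> E" "cluster_pointin weak_star_topology k u sequentially"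
    and v: "v \<in> E" "cluster_pointin weak_star_topology k v sequentially"
    and ab: "a * (h u - e) + b * (h v - e) = 0"
  shows "a *\<^sub>R u + b *\<^sub>R v = 0"
proof -
  define M where "M = closure (span (range k))"
  have M: "subspace M" unfolding M_def by (intro subspace_closure subspace_span)
  have kM: "k n \<in> M" for n unfolding M_def by (meson closure_subset rangeI span_base subsetD)
  obtain x where x: "\<And>n. k n - k 0 = ev (x n)" using differences_in_range_ev by blast
  define z where "z = a *\<^sub>R (u - k 0) + b *\<^sub>R (v - k 0)"
  have "z \<in> E"
    unfolding z_def using u(1) v(1) k(1) E by (intro subspace_add subspace_scale subspace_diff)
  moreover have "h z = 0"
    using ab by (simp add: z_def linear_add[OF h] linear_scale[OF h] linear_diff[OF h] k(2))
  ultimately obtain y where y: "z = ev y" using ker_h by blast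
  have "z \<in> span {q. cluster_pointin weak_star_topology (\<lambda>n. ev (x n)) q sequentially}"
    unfolding z_def x[symmetric] using cluster_pointin_weak_star_diff u(2) v(2)
    by (intro span_add span_scale span_base) auto
  then have "z \<in> closure (span (ev ` range x))"
    unfolding y by (intro ev_closure_span in_closure_span_if_ev_in_span_cluster_points)
  also have "\<dots> \<subseteq> M"
  proof (rule closure_minimal[OF span_minimal[OF _ M]])
    show "ev ` range x \<subseteq> M" using subspace_diff[OF M kM kM] by (auto simp flip: x)
  qed (simp add: M_def)
  finally have "z + (a + b) *\<^sub>R k 0 \<in> M" using M kM by (intro subspace_add subspace_scale)
  then have "a *\<^sub>R u + b *\<^sub>R v \<in> M" by (simp add: z_def algebra_simps)
  moreover have "a *\<^sub>R u + b *\<^sub>R v \<in> span {q. cluster_pointin weak_star_topology k q sequentially}"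
    using u(2) v(2) by (intro span_add span_scale span_base) auto
  ultimately show ?thesis using whitley unfolding whitley_sequence_def M_def by blast
qed

lemma cluster_value_neq:
  assumes u: "u \<in> E" "cluster_pointin weak_star_topology k u sequentially"
  shows "h u \<noteq> e"
proof
  assume "h u = e"
  then have "u = 0" using cluster_combination_eq_0[OF u u, of 1 0] by simp
  with \<open>h u = e\<close> e show False by (simp add: linear_0[OF h])
qed

lemma cluster_unique:
  assumes u: "u \<in> E" "cluster_pointin weak_star_topology k u sequentially"
    and v: "v \<in> E" "cluster_pointin weak_star_topology k v sequentially"
  shows "u = v"
proof -
  have eq: "(h v - e) *\<^sub>R u + (e - h u) *\<^sub>R v = 0"
    by (rule cluster_combination_eq_0[OF u v]) (simp add: algebra_simps)
  then have "h ((h v - e) *\<^sub>R u + (e - h u) *\<^sub>R v) = 0" by (simp only: linear_0[OF h])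
  then have "(h v - e) * h u + (e - h u) * h v = 0"
    by (simp add: linear_add[OF h] linear_scale[OF h])
  then have "e * (h v - h u) = 0" by (simp add: algebra_simps)
  then have same: "h v = h u" using e by simp
  from eq have "(h u - e) *\<^sub>R (u - v) = 0" unfolding same by (simp add: algebra_simps)
  then show ?thesis using cluster_value_neq[OF u] by simp
qed

end

lemma baire_one_if_0_in_closure_of_level_set:
  fixes E :: "(('a::real_normed_vector \<Rightarrow>\<^sub>L real) \<Rightarrow>\<^sub>L real) set" and h :: "_ \<Rightarrow> real"
  assumes E: "subspace E" and h: "linear h" and ker_h: "\<And>y. y \<in> E \<Longrightarrow> h y = 0 \<Longrightarrow> y \<in> range ev"
    and K: "K \<in> mackey_sets E" and e: "e > 0"
    and closure: "0 \<in> weak_star_topology closure_of {k \<in> K. h k = e}"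
  shows "\<exists>\<psi>\<in>E \<inter> baire_one. h \<psi> \<noteq> 0"
proof -
  have KE: "K \<subseteq> E" and compact: "compactin weak_star_topology K"
    using K by (auto simp: mackey_sets_def)
  obtain k where whitley: "whitley_sequence k" and "\<And>n. k n \<in> {k \<in> K. h k = e}"
    using whitley_sequence_exists[OF closure] by blast
  then have kK: "k n \<in> K" and kE: "k n \<in> E" and hk: "h (k n) = e" for n using KE by auto
  interpret whitley_level_sequence E h k e
    by (rule whitley_level_sequence.intro[OF E h ker_h kE hk _ whitley]) (use e in simp_all)
  obtain u where u: "u \<in> K" "cluster_pointin weak_star_topology k u sequentially"
    using compactin_imp_cluster_point[OF compact, of sequentially k] kK by auto
  have uE: "u \<in> E" using u(1) KE by blast
  have "limitin weak_star_topology k u sequentially"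
    using compact kK KE uE u(2) cluster_unique
    by (intro limitin_if_unique_cluster_point) auto
  then have "limitin weak_star_topology (\<lambda>n. k n - k 0) (u - k 0) sequentially"
    by (auto simp: limitin_weak_star_iff blinfun.diff_left intro: tendsto_diff)
  moreover obtain x where "\<And>n. k n - k 0 = ev (x n)"
    using differences_in_range_ev by blast
  ultimately have "u - k 0 \<in> baire_one" by (auto simp: baire_one_def)
  moreover have "u - k 0 \<in> E" using E uE kE by (rule subspace_diff)
  moreover have "h (u - k 0) \<noteq> 0"
    using cluster_value_neq[OF uE u(2)] hk by (simp add: linear_diff[OF h])
  ultimately show ?thesis by blast
qed

lemma mackey_complete_imp_0_in_closure_of_level_set:
  fixes E :: "(('a::real_normed_vector \<Rightarrow>\<^sub>L real) \<Rightarrow>\<^sub>L real) set" and h :: "_ \<Rightarrow> real"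
  assumes E: "subspace E" "mackey_complete E" "range ev \<subseteq> E"
    and h: "linear h" "\<And>x. h (ev x) = 0" and \<phi>: "\<phi> \<in> E" "h \<phi> \<noteq> 0"
  obtains K e where "K \<in> mackey_sets E" "e > 0" "0 \<in> weak_star_topology closure_of {k \<in> K. h k = e}"
proof (rule ccontr)
  assume "\<not> thesis"
  with that have "\<exists>f. \<forall>y\<in>E. blinfun_apply y f = h y"
    by (intro grothendieck_completeness[OF E(1,2) h(1)]) blast
  then obtain f where f: "\<And>y. y \<in> E \<Longrightarrow> blinfun_apply y f = h y" by blast
  have "f x = 0" for x using f[of "ev x"] E(3) h(2) by auto
  then have "f = 0" by (intro blinfun_eqI) simp
  with f[OF \<phi>(1)] \<phi>(2) show False by (simp add: blinfun.zero_right)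
qed

lemma baire_one_if_mackey_complete_span_insert:
  fixes \<phi> :: "('a::banach \<Rightarrow>\<^sub>L real) \<Rightarrow>\<^sub>L real"
  assumes complete: "mackey_complete (span (insert \<phi> (range ev)))"
  shows "\<phi> \<in> baire_one"
proof (cases "\<phi> \<in> range ev")
  case False
  then obtain h :: "(('a \<Rightarrow>\<^sub>L real) \<Rightarrow>\<^sub>L real) \<Rightarrow>\<^sub>L real"
    where h: "\<And>s. s \<in> range ev \<Longrightarrow> h s = 0" "h \<phi> = 1"
    using hahn_banach_closed_subspace[OF subspace_range_ev closed_range_ev] by blast
  have lin: "linear h" by (rule linear_blinfun_apply)
  define E where "E = span (insert \<phi> (range ev))"
  have E: "subspace E" "\<phi> \<in> E" "range ev \<subseteq> E" by (auto simp: E_def span_base)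
  have decompose: "y \<in> E \<longleftrightarrow> y - h y *\<^sub>R \<phi> \<in> range ev" for y
    unfolding E_def using subspace_range_ev lin h by (rule in_span_insert_subspace_iff)
  have "mackey_complete E" using complete by (simp add: E_def)
  from mackey_complete_imp_0_in_closure_of_level_set[OF E(1) this E(3) lin _ E(2)] h
  obtain K e where "K \<in> mackey_sets E" "e > 0" "0 \<in> weak_star_topology closure_of {k \<in> K. h k = e}"
    by auto
  moreover have "y \<in> range ev" if "y \<in> E" "h y = 0" for y using decompose[of y] that by simp
  ultimately obtain \<psi> where \<psi>: "\<psi> \<in> E" "\<psi> \<in> baire_one" "h \<psi> \<noteq> 0"
    using baire_one_if_0_in_closure_of_level_set[OF E(1) lin] by blast
  have "\<psi> - h \<psi> *\<^sub>R \<phi> \<in> baire_one" using \<psi>(1) decompose range_ev_subset_baire_one by blast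
  from subspace_diff[OF subspace_baire_one \<psi>(2) this] have "h \<psi> *\<^sub>R \<phi> \<in> baire_one" by simp
  from subspace_scale[OF subspace_baire_one this, of "1 / h \<psi>"] \<psi>(3) show ?thesis by simp
qed (use range_ev_subset_baire_one in blast)

theorem theorem4p5:
  assumes "fully_mackey_complete TYPE('a::banach \<Rightarrow>\<^sub>L real)"
  shows "\<forall>\<phi> :: ('a \<Rightarrow>\<^sub>L real) \<Rightarrow>\<^sub>L real. \<exists>x :: nat \<Rightarrow> 'a.
           \<forall>f :: 'a \<Rightarrow>\<^sub>L real. (\<lambda>n. blinfun_apply f (x n)) \<longlonglongrightarrow> blinfun_apply \<phi> f"
proof
  fix \<phi> :: "('a \<Rightarrow>\<^sub>L real) \<Rightarrow>\<^sub>L real"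
  let ?E = "span (insert \<phi> (range ev))"
  have "closed ?E" using subspace_range_ev closed_range_ev by (rule closed_span_insert)
  moreover have "norming ?E" by (rule norming_if_range_ev_subset) (auto intro: span_base)
  ultimately have "mackey_complete ?E"
    using assms subspace_span unfolding fully_mackey_complete_def by blast
  then have "\<phi> \<in> baire_one" by (rule baire_one_if_mackey_complete_span_insert)
  then show "\<exists>x. \<forall>f. (\<lambda>n. blinfun_apply f (x n)) \<longlonglongrightarrow> blinfun_apply \<phi> f"
    by (simp add: baire_one_def limitin_weak_star_iff)
qed

end
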